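(* Let $\epsilon>\delta>0$, let $0<\eta<\epsilon-\delta$, and let $C>0$. Then there exist $n_0$ and a constant $K>0$ (independent of $n$ and $f$) such that for every $n\in S$ with $n\ge n_0$ satisfying $$\min_{\lambda\neq\lambda'\in\mathcal{E}_n}\|\lambda-\lambda'\|>C\, n^{1/2-\delta},$$ and every function $f=f_n$ of the form described in the context, we have $$\sup_{x\in\mathbb{T},\ r>n^{-1/2+\epsilon}}\left|\frac{\int_{B_x(r)}f(y)^2\,dy}{\pi r^2}-1\right|\le K\, n^{-3\eta/2}.$$
   Context: Let $\mathbb{T}=\mathbb{R}^2/\mathbb{Z}^2$ and $e(t)=e^{2\pi i t}$. Let $S=\{a^2+b^2: a,b\in\mathbb{Z}\}$. For $n\in S$ let $\mathcal{E}_n=\{\lambda\in\mathbb{Z}^2:\|\lambda\|^2=n\}$ and $r_2(n)=\#\mathcal{E}_n$. For $n\in S$ we consider functions $f_n(x)=\sum_{\lambda\in\mathcal{E}_n}c_\lambda e(\langle x,\lambda\rangle)$ (Laplace eigenfunctions on $\mathbb{T}$) with $c_{-\lambda}=\overline{c_\lambda}$ (so $f_n$ is real valued) and $\sum_{\lambda\in\mathcal{E}_n}|c_\lambda|^2=1$ (so $\|f_n\|_{L^2(\mathbb{T})}=1$). For $x\in\mathbb{T}$ and $r>0$, $\int_{B_x(r)}f(y)^2dy$ denotes the integral of $f^2$ (viewed as a $\mathbb{Z}^2$-periodic function on $\mathbb{R}^2$) over the Euclidean disc of radius $r$ centred at a lift of $x$. *)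

theory Defs
  imports "HOL-Analysis.Analysis"
begin

definition unit_exp :: "real \<Rightarrow> complex"
  where "unit_exp t = exp (2 * of_real pi * \<i> * of_real t)"

definition sums_of_two_squares :: "nat set"
  where "sums_of_two_squares = {n. \<exists>a b :: int. int n = a\<^sup>2 + b\<^sup>2}"

definition lattice_points :: "nat \<Rightarrow> (real \<times> real) set"
  where "lattice_points n = {v. fst v \<in> \<int> \<and> snd v \<in> \<int> \<and> (norm v)\<^sup>2 = real n}"

(* For n > 0 in sums_of_two_squares, the set below is finite and nonempty (it contains
   norm (v - (-v))).  For n = 0 it is empty and its Min is unspecified. *)
definition min_separation :: "nat \<Rightarrow> real"
  where "min_separation n =
    Min {norm (v - w) | v w. v \<in> lattice_points n \<and> w \<in> lattice_points n \<and> v \<noteq> w}"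

(* Functions on the torus are represented by their periodic lifts to the plane.  The condition
   on c makes the exponential sum real, so requiring f to be real valued is no restriction. *)
definition normalized_eigenfunction :: "nat \<Rightarrow> (real \<times> real \<Rightarrow> real) \<Rightarrow> bool"
  where "normalized_eigenfunction n f \<longleftrightarrow>
    (\<exists>c :: real \<times> real \<Rightarrow> complex.
       (\<forall>v \<in> lattice_points n. c (- v) = cnj (c v)) \<and>
       (\<Sum>v \<in> lattice_points n. (cmod (c v))\<^sup>2) = 1 \<and>
       (\<forall>x. complex_of_real (f x) = (\<Sum>v \<in> lattice_points n. c v * unit_exp (x \<bullet> v))))"

end

theory Submission
  imports Defs
begin

text \<open>
  Expanding \<open>f\<^sup>2\<close> and integrating over a disc, the diagonal terms give exactly \<open>\<pi> r\<^sup>2\<close>, and the pair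
  \<open>v \<noteq> w\<close> contributes the Fourier transform of the disc at \<open>v - w\<close>, which relative to \<open>\<pi> r\<^sup>2\<close> is
  \<open>O((r \<parallel>v - w\<parallel>)\<^bsup>-3/2\<^esup>)\<close>.  That decay is obtained without Bessel functions: the transform is that of a
  semicircle profile, and shifting by half a period in both directions replaces the profile by its
  second difference, whose \<open>L\<^sup>1\<close> norm is small by concavity.

  Points on a circle with mutual distances at least \<open>d\<close> satisfy
  \<open>\<Sum>\<^bsub>w \<noteq> v\<^esub> \<parallel>v - w\<parallel>\<^bsup>-3/2\<^esup> = O(d\<^bsup>-3/2\<^esup>)\<close>, because the \<open>j\<close>-th neighbour is at distance of order at
  least \<open>j d\<close>.  Schur's test then bounds all off-diagonal terms by \<open>O((r d)\<^bsup>-3/2\<^esup>)\<close>, so no divisor bound for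
  the number of lattice points is needed.
\<close>

section \<open>The Fourier transform of a disc\<close>

lemma unit_exp_eq_cis: "unit_exp t = cis (2 * pi * t)"
  unfolding unit_exp_def cis_conv_exp by (simp add: mult_ac)

lemma norm_unit_exp [simp]: "norm (unit_exp t) = 1"
  by (simp add: unit_exp_eq_cis)

lemma unit_exp_add: "unit_exp (s + t) = unit_exp s * unit_exp t"
  by (simp add: unit_exp_eq_cis cis_mult distrib_left)

lemma unit_exp_zero [simp]: "unit_exp 0 = 1"
  by (simp add: unit_exp_eq_cis)

lemma cnj_unit_exp: "cnj (unit_exp t) = unit_exp (- t)"
  by (simp add: unit_exp_eq_cis cis_cnj)

text \<open>Half a period flips the sign of the character; this is the source of all cancellation in
  \<open>semicircle_fourier_bound\<close>. The shift stands on the left to match the affine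
  substitution rules for \<open>lborel\<close>.\<close>

lemma unit_exp_half_shift:
  "unit_exp (1/2 + s) = - unit_exp s" "unit_exp (-1/2 + s) = - unit_exp s"
proof -
  have "unit_exp (1/2) = -1" "unit_exp (-1/2) = -1"
    by (simp_all add: unit_exp_eq_cis complex_eq_iff)
  then show "unit_exp (1/2 + s) = - unit_exp s" "unit_exp (-1/2 + s) = - unit_exp s"
    by (simp_all only: unit_exp_add) simp_all
qed

lemma continuous_on_unit_exp [continuous_intros]:
  "continuous_on S f \<Longrightarrow> continuous_on S (\<lambda>x. unit_exp (f x))"
  unfolding unit_exp_def by (intro continuous_intros)

lemma borel_measurable_unit_exp [measurable]: "unit_exp \<in> borel_measurable borel"
  by (intro borel_measurable_continuous_onI continuous_intros)

section \<open>The semicircle profile and the decay of its Fourier transform\<close>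

text \<open>Half the length of the chord at distance \<open>\<bar>s\<bar>\<close> from the centre of
  a disc of radius \<open>\<rho>\<close>. Truncating at 0 extends it continuously by zero to the
  whole line, so that it can be shifted freely.\<close>

definition semicircle :: "real \<Rightarrow> real \<Rightarrow> real"
  where "semicircle \<rho> s = sqrt (max 0 (\<rho>\<^sup>2 - s\<^sup>2))"

lemma semicircle_nonneg: "semicircle \<rho> s \<ge> 0"
  by (simp add: semicircle_def)

lemma semicircle_eq_0: "\<rho> \<ge> 0 \<Longrightarrow> \<rho> \<le> \<bar>s\<bar> \<Longrightarrow> semicircle \<rho> s = 0"
  using abs_le_square_iff[of \<rho> s] by (simp add: semicircle_def max_def)

lemma continuous_on_semicircle: "continuous_on S (semicircle \<rho>)"
  unfolding semicircle_def by (intro continuous_intros)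

lemma integrable_semicircle_times:
  fixes h :: "real \<Rightarrow> 'a :: euclidean_space"
  assumes "\<rho> \<ge> 0" "continuous_on UNIV h"
  shows "integrable lborel (\<lambda>s. semicircle \<rho> s *\<^sub>R h s)"
proof -
  have "integrable lborel (\<lambda>s. indicator {-\<rho>..\<rho>} s *\<^sub>R (semicircle \<rho> s *\<^sub>R h s))"
    by (intro borel_integrable_compact continuous_intros continuous_on_semicircle
        continuous_on_subset[OF assms(2)]) auto
  moreover have "indicator {-\<rho>..\<rho>} s *\<^sub>R (semicircle \<rho> s *\<^sub>R h s) = semicircle \<rho> s *\<^sub>R h s" for s
    using semicircle_eq_0[OF assms(1), of s] by (cases "\<rho> \<le> \<bar>s\<bar>") (auto simp: indicator_def)
  ultimately show ?thesis by (simp only:)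
qed

text \<open>For \<open>\<rho> \<ge> 1\<close> the square of the profile is at most
  \<open>\<rho>\<^sup>2 - (\<rho> - 1)\<^sup>2 < 2 * \<rho>\<close>; for smaller
  \<open>\<rho>\<close> already \<open>\<rho>\<^sup>2 \<le> \<rho>\<close>. The width 1 allows for a
  window of half-width 1/2 around an edge followed by a shift by 1/2.\<close>

lemma semicircle_near_edge:
  assumes "\<rho> \<ge> 0" "\<bar>s\<bar> \<ge> \<rho> - 1"
  shows "semicircle \<rho> s \<le> sqrt (2 * \<rho>)"
proof -
  have "\<rho>\<^sup>2 - s\<^sup>2 \<le> 2 * \<rho>"
  proof (cases "\<rho> \<ge> 1")
    case True
    then have "(\<rho> - 1)\<^sup>2 \<le> s\<^sup>2"
      using assms abs_le_square_iff[of "\<rho> - 1" s] by simp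
    then show ?thesis by (simp add: power2_eq_square algebra_simps)
  next
    case False
    then have "\<rho>\<^sup>2 \<le> \<rho>"
      using assms by (simp add: power2_eq_square mult_left_le_one_le)
    then show ?thesis using assms zero_le_power2[of s] by linarith
  qed
  then show ?thesis
    using assms by (simp add: semicircle_def)
qed

text \<open>The parallelogram identity bounds the square of the sum of the two outer values by four
  times the square of the middle one. Both outer points must stay within the support, since the
  extension by zero is not concave across an edge.\<close>

lemma semicircle_midpoint_concave:
  assumes "\<bar>s + h\<bar> \<le> \<rho>" "\<bar>s - h\<bar> \<le> \<rho>"
  shows "semicircle \<rho> (s + h) + semicircle \<rho> (s - h) \<le> 2 * semicircle \<rho> s"
proof -
  define A B where "A = semicircle \<rho> (s + h)" and "B = semicircle \<rho> (s - h)"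
  have nn: "(s + h)\<^sup>2 \<le> \<rho>\<^sup>2" "(s - h)\<^sup>2 \<le> \<rho>\<^sup>2" "s\<^sup>2 \<le> \<rho>\<^sup>2"
    using assms by (auto simp flip: abs_le_square_iff)
  have AB: "A\<^sup>2 = \<rho>\<^sup>2 - (s + h)\<^sup>2" "B\<^sup>2 = \<rho>\<^sup>2 - (s - h)\<^sup>2"
    using nn by (simp_all add: A_def B_def semicircle_def)
  have "(A + B)\<^sup>2 + (A - B)\<^sup>2 = 2 * A\<^sup>2 + 2 * B\<^sup>2"
    by (simp add: power2_eq_square algebra_simps)
  also have "\<dots> = 4 * (\<rho>\<^sup>2 - s\<^sup>2) - 4 * h\<^sup>2"
    unfolding AB by (simp add: power2_eq_square algebra_simps)
  finally have "(A + B)\<^sup>2 \<le> 4 * (\<rho>\<^sup>2 - s\<^sup>2)"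
    using zero_le_power2[of "A - B"] zero_le_power2[of h] by linarith
  also have "\<dots> = (2 * semicircle \<rho> s)\<^sup>2"
    using nn by (simp add: semicircle_def power_mult_distrib)
  finally show ?thesis
    unfolding A_def B_def using semicircle_nonneg by (meson power2_le_imp_le mult_nonneg_nonneg zero_le_numeral)
qed

text \<open>By concavity the second difference is negative only within distance \<open>1/2\<close> of the two edges;
  since its integral vanishes, this controls its \<open>L\<^sup>1\<close> norm.\<close>
lemma semicircle_second_difference:
  fixes s \<rho> :: real
  defines "D \<equiv> 2 * semicircle \<rho> s - semicircle \<rho> (1/2 + s) - semicircle \<rho> (-1/2 + s)"
  assumes "\<rho> \<ge> 0"
  shows "\<bar>D\<bar> \<le> D + 4 * sqrt (2 * \<rho>) *
    (indicator {\<rho> - 1/2..\<rho> + 1/2} s + indicator {- \<rho> - 1/2..- \<rho> + 1/2} s)"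
proof -
  define E where "E = (indicator {\<rho> - 1/2..\<rho> + 1/2} s + indicator {- \<rho> - 1/2..- \<rho> + 1/2} s :: real)"
  have E: "E \<ge> 0" by (simp add: E_def)
  consider "\<bar>s\<bar> > \<rho> + 1/2" | "\<bar>s\<bar> < \<rho> - 1/2" | "\<rho> - 1/2 \<le> \<bar>s\<bar>" "\<bar>s\<bar> \<le> \<rho> + 1/2" by linarith
  then have "\<bar>D\<bar> \<le> D + 4 * sqrt (2 * \<rho>) * E"
  proof cases
    case 1
    then have "D = 0" using assms by (simp add: D_def semicircle_eq_0)
    then show ?thesis using E assms by simp
  next
    case 2
    then have "\<bar>s + 1/2\<bar> \<le> \<rho>" "\<bar>s - 1/2\<bar> \<le> \<rho>" by linarith+
    then have "D \<ge> 0"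
      using semicircle_midpoint_concave[of s "1/2" \<rho>] by (simp add: D_def add.commute)
    then show ?thesis using E assms by simp
  next
    case 3
    have "semicircle \<rho> (1/2 + s) \<le> sqrt (2 * \<rho>)" "semicircle \<rho> (-1/2 + s) \<le> sqrt (2 * \<rho>)"
      using 3 assms by (auto intro!: semicircle_near_edge)
    \<comment> \<open>Since \<open>\<bar>D\<bar>\<close> exceeds \<open>D\<close> by twice the
      negative part of \<open>D\<close>, this bound doubles to the constant 4 of the claim.\<close>
    then have "-D \<le> 2 * sqrt (2 * \<rho>)"
      using semicircle_nonneg[of \<rho> s] by (simp add: D_def)
    moreover have "E \<ge> 1" using 3 by (auto simp: E_def indicator_def)
    then have "4 * sqrt (2 * \<rho>) * 1 \<le> 4 * sqrt (2 * \<rho>) * E"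
      using assms by (intro mult_left_mono) auto
    moreover have "sqrt (2 * \<rho>) \<ge> 0" using assms by simp
    ultimately show ?thesis by linarith
  qed
  then show ?thesis by (simp add: E_def)
qed

text \<open>Each half-period shift of the profile has transform \<open>- I\<close>, so the second
  difference has transform \<open>4 * I\<close>. Its \<open>L1\<close> norm is at most
  \<open>8 * sqrt (2 * \<rho>)\<close>, which gives the claim after division by 4.\<close>

lemma semicircle_fourier_bound:
  assumes "\<rho> \<ge> 0"
  shows "norm (LINT s|lborel. semicircle \<rho> s *\<^sub>R unit_exp s) \<le> 2 * sqrt (2 * \<rho>)"
proof -
  let ?g = "semicircle \<rho>"
  define D where "D s = 2 * ?g s - ?g (1/2 + s) - ?g (-1/2 + s)" for s
  define E where "E s = (indicator {\<rho> - 1/2..\<rho> + 1/2} s + indicator {- \<rho> - 1/2..- \<rho> + 1/2} s :: real)" for s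
  define I where "I = (LINT s|lborel. ?g s *\<^sub>R unit_exp s)"
  define J where "J = (LINT s|lborel. ?g s)"
  have int: "integrable lborel (\<lambda>s. ?g s *\<^sub>R unit_exp s)"
    using assms by (intro integrable_semicircle_times continuous_intros)
  have int': "integrable lborel ?g"
    using integrable_semicircle_times[of \<rho> "\<lambda>_. 1 :: real"] assms by simp
  have shift: "integrable lborel (\<lambda>s. ?g (t + s))" "(LINT s|lborel. ?g (t + s)) = J" for t
    using lborel_integrable_real_affine[OF int', of 1 t] lborel_integral_real_affine[of 1 ?g t]
    by (simp_all add: J_def)
  have shift_e: "integrable lborel (\<lambda>s. ?g (t + s) *\<^sub>R unit_exp s)"
      "(LINT s|lborel. ?g (t + s) *\<^sub>R unit_exp s) = - I" if "t = 1/2 \<or> t = -1/2" for t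
  proof -
    \<comment> \<open>Shifting the whole integrand leaves the integral unchanged; undoing the shift
      in the character alone then costs a sign.\<close>
    have u: "?g (t + s) *\<^sub>R unit_exp (t + s) = - (?g (t + s) *\<^sub>R unit_exp s)" for s
      using that unit_exp_half_shift[of s] by (elim disjE) (simp_all only: scaleR_minus_right)
    have "integrable lborel (\<lambda>s. ?g (t + s) *\<^sub>R unit_exp (t + s))"
      using lborel_integrable_real_affine[OF int, of 1 t] by simp
    then show "integrable lborel (\<lambda>s. ?g (t + s) *\<^sub>R unit_exp s)" 
      unfolding u using Bochner_Integration.integrable_minus by fastforce
    have "I = (LINT s|lborel. ?g (t + s) *\<^sub>R unit_exp (t + s))"
      unfolding I_def using lborel_integral_real_affine[of 1 "\<lambda>s. ?g s *\<^sub>R unit_exp s" t] by simp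
    then show "(LINT s|lborel. ?g (t + s) *\<^sub>R unit_exp s) = - I"
      unfolding u by simp
  qed
  have ind: "integrable lborel E" "(LINT s|lborel. E s) = 2"
    by (simp_all add: E_def[abs_def])
  have "(LINT s|lborel. D s *\<^sub>R unit_exp s) = (LINT s|lborel. 2 *\<^sub>R (?g s *\<^sub>R unit_exp s)
      - ?g (1/2 + s) *\<^sub>R unit_exp s - ?g (-1/2 + s) *\<^sub>R unit_exp s)"
    by (simp only: D_def scaleR_diff_left scaleR_scaleR)
  also have "\<dots> = 2 *\<^sub>R I - (- I) - (- I)"
  proof -
    have i: "integrable lborel (\<lambda>s. 2 *\<^sub>R (?g s *\<^sub>R unit_exp s))"
      using int by (intro integrable_scaleR_right)
    have e: "integrable lborel (\<lambda>s. ?g (1/2 + s) *\<^sub>R unit_exp s)"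
        "integrable lborel (\<lambda>s. ?g (-1/2 + s) *\<^sub>R unit_exp s)"
      by (rule shift_e(1); simp)+
    show ?thesis
      by (simp only: Bochner_Integration.integral_diff Bochner_Integration.integrable_diff i e
          integral_scaleR_right shift_e(2) simp_thms I_def)
  qed
  also have "\<dots> = 4 * I" by (simp add: scaleR_conv_of_real)
  finally have I: "4 * I = (LINT s|lborel. D s *\<^sub>R unit_exp s)" ..
  have D: "integrable lborel D" "(LINT s|lborel. D s) = 0"
  proof -
    have i: "integrable lborel (\<lambda>s. 2 * ?g s)" "(LINT s|lborel. 2 * ?g s) = 2 * J"
      using int' by (simp_all add: J_def)
    show "integrable lborel D" "(LINT s|lborel. D s) = 0"
      unfolding D_def
      by (simp_all only: Bochner_Integration.integral_diff Bochner_Integration.integrable_diff i shift)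
  qed
  have "4 * norm I = norm (4 * I)" by (simp add: norm_mult)
  also have "\<dots> \<le> (LINT s|lborel. norm (D s *\<^sub>R unit_exp s))"
    unfolding I by (rule integral_norm_bound)
  also have "\<dots> = (LINT s|lborel. \<bar>D s\<bar>)" by simp
  \<comment> \<open>\<open>D\<close> has integral zero because the Lebesgue integral is translation
    invariant, so only the two edge windows, each of length 1, contribute to the right-hand
    side.\<close>
  also have "\<dots> \<le> (LINT s|lborel. D s + 4 * sqrt (2 * \<rho>) * E s)"
  proof (rule integral_mono)
    show "\<bar>D s\<bar> \<le> D s + 4 * sqrt (2 * \<rho>) * E s" for s
      unfolding D_def E_def by (rule semicircle_second_difference[OF assms])
  qed (use D ind in auto)
  also have "\<dots> = 8 * sqrt (2 * \<rho>)"
    using D ind by simp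
  finally show ?thesis by (simp add: I_def)
qed

section \<open>From the planar disc to the semicircle profile\<close>

text \<open>Completing the square in \<open>y\<close> shows the slice to be an interval with centre
  \<open>s * b / N\<close> and half-width \<open>w\<close>. The profile has radius
  \<open>sqrt N * r\<close>, the largest value of the linear form \<open>(a, b)\<close> on the
  closed disc.\<close>

lemma sheared_disc_slice:
  fixes a b r s :: real
  assumes "a \<noteq> 0"
  defines "N \<equiv> a\<^sup>2 + b\<^sup>2"
  shows "measure lborel {y. ((s - b * y) / a)\<^sup>2 + y\<^sup>2 < r\<^sup>2} = 2 * \<bar>a\<bar> * semicircle (sqrt N * r) s / N"
proof -
  have N: "N > 0" using assms by (simp add: N_def sum_power2_gt_zero_iff)
  define w where "w = \<bar>a\<bar> * semicircle (sqrt N * r) s / N"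
  have w0: "w \<ge> 0" using N by (simp add: w_def semicircle_nonneg)
  have w2: "w\<^sup>2 = a\<^sup>2 * max 0 (N * r\<^sup>2 - s\<^sup>2) / N\<^sup>2"
    using N by (simp add: w_def semicircle_def power_mult_distrib power_divide)
  have key: "((s - b * y) / a)\<^sup>2 + y\<^sup>2 < r\<^sup>2 \<longleftrightarrow> (y - s * b / N)\<^sup>2 < a\<^sup>2 * (N * r\<^sup>2 - s\<^sup>2) / N\<^sup>2" for y
  proof -
    have "((s - b * y) / a)\<^sup>2 + y\<^sup>2 < r\<^sup>2 \<longleftrightarrow> (s - b * y)\<^sup>2 + a\<^sup>2 * y\<^sup>2 < a\<^sup>2 * r\<^sup>2"
      using assms by (simp add: power_divide field_simps)
    also have "\<dots> \<longleftrightarrow> N * ((s - b * y)\<^sup>2 + a\<^sup>2 * y\<^sup>2) < N * (a\<^sup>2 * r\<^sup>2)"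
      using N by simp
    also have "\<dots> \<longleftrightarrow> (N * y - s * b)\<^sup>2 < a\<^sup>2 * (N * r\<^sup>2 - s\<^sup>2)"
    proof -
      have "N * ((s - b * y)\<^sup>2 + a\<^sup>2 * y\<^sup>2) = (N * y - s * b)\<^sup>2 + a\<^sup>2 * s\<^sup>2"
        unfolding N_def by algebra
      then show ?thesis by (simp add: algebra_simps)
    qed
    also have "\<dots> \<longleftrightarrow> (y - s * b / N)\<^sup>2 < a\<^sup>2 * (N * r\<^sup>2 - s\<^sup>2) / N\<^sup>2"
    proof -
      have "N * y - s * b = N * (y - s * b / N)" using N by (simp add: field_simps)
      then show ?thesis using N by (simp add: power_mult_distrib field_simps)
    qed
    finally show ?thesis .
  qed
  have "{y. ((s - b * y) / a)\<^sup>2 + y\<^sup>2 < r\<^sup>2} = {s * b / N - w <..< s * b / N + w}"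
  proof -
    have "((s - b * y) / a)\<^sup>2 + y\<^sup>2 < r\<^sup>2 \<longleftrightarrow> \<bar>y - s * b / N\<bar> < w" for y
    proof (cases "N * r\<^sup>2 - s\<^sup>2 \<ge> 0")
      case True
      then have "((s - b * y) / a)\<^sup>2 + y\<^sup>2 < r\<^sup>2 \<longleftrightarrow> (y - s * b / N)\<^sup>2 < w\<^sup>2"
        by (simp add: key w2)
      also have "\<dots> \<longleftrightarrow> \<bar>y - s * b / N\<bar> < w"
        using w0 abs_le_square_iff[of w "y - s * b / N"] by (simp add: not_le[symmetric])
      finally show ?thesis .
    next
      \<comment> \<open>Here the line misses the disc: the slice is empty, in agreement with the
        value 0 of \<open>semicircle\<close> outside its support.\<close>
      case False
      then have "w\<^sup>2 = 0" by (simp add: w2)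
      moreover have "a\<^sup>2 * (N * r\<^sup>2 - s\<^sup>2) / N\<^sup>2 \<le> 0"
        using False by (intro divide_nonpos_nonneg mult_nonneg_nonpos) auto
      then have "\<not> (y - s * b / N)\<^sup>2 < a\<^sup>2 * (N * r\<^sup>2 - s\<^sup>2) / N\<^sup>2"
        using zero_le_power2[of "y - s * b / N"] by linarith
      ultimately show ?thesis by (simp add: key)
    qed
    then have "{y. ((s - b * y) / a)\<^sup>2 + y\<^sup>2 < r\<^sup>2} = {y. \<bar>y - s * b / N\<bar> < w}" by simp
    also have "\<dots> = {s * b / N - w <..< s * b / N + w}" by (auto simp: abs_less_iff)
    finally show ?thesis .
  qed
  then show ?thesis using w0 by (simp add: w_def)
qed

lemma mem_disc_iff:
  fixes x y r :: real
  assumes "r > 0"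
  shows "(x, y) \<in> ball 0 r \<longleftrightarrow> x\<^sup>2 + y\<^sup>2 < r\<^sup>2"
proof -
  have "(x, y) \<in> ball 0 r \<longleftrightarrow> sqrt (x\<^sup>2 + y\<^sup>2) < sqrt (r\<^sup>2)"
    using assms by (simp add: norm_Pair)
  then show ?thesis by (simp only: real_sqrt_less_iff)
qed

lemma integrable_indicator_bounded_times:
  fixes h :: "'a :: euclidean_space \<Rightarrow> complex"
  assumes "bounded A" "A \<in> sets borel" "h \<in> borel_measurable borel" "\<And>x. norm (h x) \<le> B"
  shows "integrable lborel (\<lambda>x. indicator A x *\<^sub>R h x)"
proof (rule integrableI_bounded_set[where A = A and B = B])
  show "emeasure lborel A < \<infinity>" using assms(1) by (rule emeasure_bounded_finite)
qed (use assms in auto)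

text \<open>Shearing the first coordinate to \<open>s = y \<bullet> (a, b)\<close> makes the planar integral one-dimensional.\<close>
lemma disc_fourier_eq:
  fixes a b r :: real
  assumes "a \<noteq> 0" "r > 0"
  defines "N \<equiv> a\<^sup>2 + b\<^sup>2"
  shows "(LINT y:ball 0 r|lborel. unit_exp (y \<bullet> (a, b)))
    = (2 / N) *\<^sub>R (LINT s|lborel. semicircle (sqrt N * r) s *\<^sub>R unit_exp s)"
proof -
  define S where "S = {(s, y). ((s - b * y) / a)\<^sup>2 + y\<^sup>2 < r\<^sup>2}"
  define F where "F = (\<lambda>x y. indicator (ball 0 r) (x, y) *\<^sub>R unit_exp (a * x + b * y))"
  define G where "G = (\<lambda>s y. indicator S (s, y) *\<^sub>R unit_exp s)"
  have "open S" unfolding S_def case_prod_beta'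
    by (intro open_Collect_less continuous_intros) (use assms in auto)
  \<comment> \<open>\<open>S\<close> is the image of the disc under the shear \<open>(x, y)\<close>
    to \<open>(a * x + b * y, y)\<close>. Its boundedness gives both the integrability needed for
    Fubini and the finite measure of the slices.\<close>
  have "S \<subseteq> cball 0 (\<bar>a\<bar> * r + \<bar>b\<bar> * r + r)"
  proof safe
    fix s y assume "(s, y) \<in> S"
    then have *: "((s - b * y) / a)\<^sup>2 + y\<^sup>2 < r\<^sup>2" by (simp add: S_def)
    have y: "\<bar>y\<bar> \<le> r"
      using * assms zero_le_power2[of "(s - b * y) / a"] abs_le_square_iff[of y r] by linarith
    have "\<bar>(s - b * y) / a\<bar> \<le> \<bar>r\<bar>"
      unfolding abs_le_square_iff using * zero_le_power2[of y] by linarith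
    then have "\<bar>s - b * y\<bar> \<le> \<bar>a\<bar> * r" using assms by (simp add: field_simps)
    moreover have "\<bar>b * y\<bar> \<le> \<bar>b\<bar> * r" using y by (simp add: abs_mult mult_left_mono)
    ultimately have "\<bar>s\<bar> \<le> \<bar>a\<bar> * r + \<bar>b\<bar> * r" by linarith
    then show "(s, y) \<in> cball 0 (\<bar>a\<bar> * r + \<bar>b\<bar> * r + r)"
      using y norm_Pair_le[of s y] by (simp add: dist_0_norm)
  qed
  then have "bounded S" by (rule bounded_subset[OF bounded_cball])
  have intF: "integrable (lborel \<Otimes>\<^sub>M lborel) (\<lambda>(x, y). F x y)"
    unfolding F_def lborel_prod case_prod_beta'
    using integrable_indicator_bounded_times[of "ball 0 r" "\<lambda>p. unit_exp (a * fst p + b * snd p)" 1]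
    by (simp add: borel_measurable_continuous_onI continuous_intros)
  have intG: "integrable (lborel \<Otimes>\<^sub>M lborel) (\<lambda>(x, y). G x y)"
    unfolding G_def lborel_prod case_prod_beta'
    using integrable_indicator_bounded_times[of S "\<lambda>p. unit_exp (fst p)" 1] \<open>bounded S\<close> \<open>open S\<close>
    by (simp add: borel_measurable_continuous_onI continuous_intros)
  have sub: "(LINT x|lborel. F x y) = (1 / \<bar>a\<bar>) *\<^sub>R (LINT s|lborel. G s y)" for y
  proof -
    have "F (- b * y / a + 1 / a * s) y = G s y" for s
    proof -
      have "- b * y / a + 1 / a * s = (s - b * y) / a" using assms by (simp add: field_simps)
      moreover have "((s - b * y) / a, y) \<in> ball 0 r \<longleftrightarrow> (s, y) \<in> S"
        using assms by (subst mem_disc_iff) (simp_all add: S_def)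
      moreover have "a * ((s - b * y) / a) + b * y = s" using assms by simp
      ultimately show ?thesis by (simp only: F_def G_def indicator_def)
    qed
    then show ?thesis
      using lborel_integral_real_affine[of "1 / a" "\<lambda>x. F x y" "- b * y / a"] assms by simp
  qed
  \<comment> \<open>After the shear the character is constant along each slice and contributes only
    through the length of the slice.\<close>
  have slice: "(LINT y|lborel. G s y) = (2 * \<bar>a\<bar> / N) *\<^sub>R (semicircle (sqrt N * r) s *\<^sub>R unit_exp s)" for s
  proof -
    define T where "T = {y. ((s - b * y) / a)\<^sup>2 + y\<^sup>2 < r\<^sup>2}"
    have G: "G s y = indicator T y *\<^sub>R unit_exp s" for y
      by (simp add: G_def S_def T_def indicator_def)
    have "open T" unfolding T_def
      by (intro open_Collect_less continuous_intros) (use assms in auto)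
    moreover have "bounded T"
    proof -
      have "T \<subseteq> snd ` S" by (auto simp: T_def S_def image_iff)
      then show ?thesis using bounded_snd[OF \<open>bounded S\<close>] bounded_subset by blast
    qed
    then have "emeasure lborel T < \<infinity>" by (rule emeasure_bounded_finite)
    ultimately have "(LINT y|lborel. G s y) = measure lborel T *\<^sub>R unit_exp s"
      unfolding G by (subst integral_scaleR_left) auto
    then show ?thesis
      using sheared_disc_slice[OF assms(1), of s b r] by (simp add: T_def N_def)
  qed
  have "(LINT y:ball 0 r|lborel. unit_exp (y \<bullet> (a, b))) = (LINT (x, y)|(lborel \<Otimes>\<^sub>M lborel). F x y)"
    unfolding set_lebesgue_integral_def lborel_prod
    by (rule Bochner_Integration.integral_cong) (auto simp: F_def inner_prod_def mult.commute)
  also have "\<dots> = (LINT y|lborel. LINT x|lborel. F x y)"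
    using lborel_pair.integral_snd[OF intF] by simp
  also have "\<dots> = (1 / \<bar>a\<bar>) *\<^sub>R (LINT y|lborel. LINT s|lborel. G s y)"
    by (simp add: sub)
  also have "(LINT y|lborel. LINT s|lborel. G s y) = (LINT s|lborel. LINT y|lborel. G s y)"
    using lborel_pair.Fubini_integral[OF intG] .
  also have "(1 / \<bar>a\<bar>) *\<^sub>R \<dots> = (2 / N) *\<^sub>R (LINT s|lborel. semicircle (sqrt N * r) s *\<^sub>R unit_exp s)"
    unfolding slice integral_scaleR_right using assms(1) by simp
  finally show ?thesis .
qed

text \<open>The shear divides by the first coordinate of the frequency. If that coordinate vanishes,
  exchanging the two coordinates preserves the disc, the measure and the norm, and reduces to the
  previous case.\<close>

lemma disc_fourier_bound_centered:
  fixes \<xi> :: "real \<times> real"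
  assumes "\<xi> \<noteq> 0" "r > 0"
  shows "norm (LINT y:ball 0 r|lborel. unit_exp (y \<bullet> \<xi>)) \<le> 4 * sqrt (2 * (norm \<xi> * r)) / (norm \<xi>)\<^sup>2"
proof -
  have *: "norm (LINT y:ball 0 r|lborel. unit_exp (y \<bullet> (a, b)))
      \<le> 4 * sqrt (2 * (norm (a, b) * r)) / (norm (a, b))\<^sup>2" if "a \<noteq> 0" for a b :: real
  proof -
    define \<rho> where "\<rho> = norm (a, b) * r"
    have "\<rho> \<ge> 0" using assms by (simp add: \<rho>_def)
    have N: "sqrt (a\<^sup>2 + b\<^sup>2) = norm (a, b)" "a\<^sup>2 + b\<^sup>2 = (norm (a, b))\<^sup>2"
      by (simp_all add: norm_Pair)
    have "norm (LINT y:ball 0 r|lborel. unit_exp (y \<bullet> (a, b)))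
        = (2 / (norm (a, b))\<^sup>2) * norm (LINT s|lborel. semicircle \<rho> s *\<^sub>R unit_exp s)"
      unfolding disc_fourier_eq[OF that assms(2)] N(1) unfolding N(2) \<rho>_def
      by (simp only: norm_scaleR) simp
    also have "\<dots> \<le> (2 / (norm (a, b))\<^sup>2) * (2 * sqrt (2 * \<rho>))"
      using semicircle_fourier_bound[OF \<open>\<rho> \<ge> 0\<close>] by (intro mult_left_mono) auto
    finally show ?thesis by (simp add: \<rho>_def)
  qed
  obtain a b where ab: "\<xi> = (a, b)" by (cases \<xi>)
  show ?thesis
  proof (cases "a = 0")
    case False
    then show ?thesis using *[of a b] by (simp add: ab)
  next
    case True
    then have "b \<noteq> 0" using assms ab by (simp add: zero_prod_def)
    have meas: "(\<lambda>p::real \<times> real. indicator (ball 0 r) p *\<^sub>R unit_exp (p \<bullet> (b, a))) 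
        \<in> borel_measurable (lborel \<Otimes>\<^sub>M lborel)"
      unfolding lborel_prod measurable_lborel1
      by (intro borel_measurable_scaleR borel_measurable_indicator 
          borel_measurable_continuous_onI[of "\<lambda>p. unit_exp (p \<bullet> (b, a))"] continuous_intros) auto
    have "(LINT y:ball 0 r|lborel. unit_exp (y \<bullet> (a, b)))
        = (LINT y:ball 0 r|lborel. unit_exp (y \<bullet> (b, a)))"
      using lborel_pair.integral_product_swap[OF meas, symmetric]
      unfolding set_lebesgue_integral_def lborel_prod
      by (simp add: case_prod_beta' inner_prod_def indicator_def norm_prod_def add.commute)
    moreover have "norm (a, b) = norm (b, a)" by (simp add: norm_Pair add.commute)
    ultimately show ?thesis using *[OF \<open>b \<noteq> 0\<close>, of a] by (simp add: ab)
  qed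
qed

lemma integral_ball_translate:
  fixes h :: "'a :: euclidean_space \<Rightarrow> complex"
  assumes "h \<in> borel_measurable borel"
  shows "(LINT y:ball x r|lborel. h y) = (LINT y:ball 0 r|lborel. h (x + y))"
proof -
  have "(LINT y:ball x r|lborel. h y) = (LINT y|distr lborel borel ((+) x). indicator (ball x r) y *\<^sub>R h y)"
    by (simp add: set_lebesgue_integral_def lborel_distr_plus)
  also have "\<dots> = (LINT y|lborel. indicator (ball x r) (x + y) *\<^sub>R h (x + y))"
    using assms by (intro integral_distr borel_measurable_scaleR borel_measurable_indicator) auto
  also have "\<dots> = (LINT y:ball 0 r|lborel. h (x + y))"
    by (simp add: set_lebesgue_integral_def indicator_def dist_norm)
  finally show ?thesis .
qed

text \<open>Moving the centre only multiplies the transform by a number of modulus 1. Dividing by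
  the area turns \<open>sqrt \<rho> / (norm \<xi>)\<^sup>2\<close> into a multiple of
  \<open>sqrt \<rho> / \<rho>\<^sup>2\<close>, a function of \<open>\<rho> = norm \<xi> * r\<close>
  alone.\<close>

lemma disc_fourier_bound:
  fixes \<xi> x :: "real \<times> real"
  assumes "\<xi> \<noteq> 0" "r > 0"
  shows "norm (LINT y:ball x r|lborel. unit_exp (y \<bullet> \<xi>)) / (pi * r\<^sup>2) \<le> 2 * (norm \<xi> * r) powr (-3/2)"
proof -
  define \<rho> where "\<rho> = norm \<xi> * r"
  have \<rho>: "\<rho> > 0" using assms by (simp add: \<rho>_def)
  have "(LINT y:ball x r|lborel. unit_exp (y \<bullet> \<xi>)) = (LINT y:ball 0 r|lborel. unit_exp ((x + y) \<bullet> \<xi>))"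
    by (intro integral_ball_translate borel_measurable_continuous_onI continuous_intros)
  also have "\<dots> = unit_exp (x \<bullet> \<xi>) * (LINT y:ball 0 r|lborel. unit_exp (y \<bullet> \<xi>))"
    by (simp add: inner_add_left unit_exp_add)
  finally have "norm (LINT y:ball x r|lborel. unit_exp (y \<bullet> \<xi>)) \<le> 4 * sqrt (2 * \<rho>) / (norm \<xi>)\<^sup>2"
    using disc_fourier_bound_centered[OF assms] by (simp add: norm_mult \<rho>_def)
  then have "norm (LINT y:ball x r|lborel. unit_exp (y \<bullet> \<xi>)) / (pi * r\<^sup>2) 
      \<le> 4 * sqrt (2 * \<rho>) / (norm \<xi>)\<^sup>2 / (pi * r\<^sup>2)"
    using assms by (intro divide_right_mono) auto
  also have "\<dots> = (4 * sqrt 2 / pi) * (sqrt \<rho> / \<rho>\<^sup>2)"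
    by (simp add: \<rho>_def real_sqrt_mult power_mult_distrib mult_ac)
  also have "sqrt \<rho> / \<rho>\<^sup>2 = \<rho> powr (-3/2)"
    using \<rho> powr_diff[of \<rho> "1/2" 2] by (simp add: powr_half_sqrt)
  also have "4 * sqrt 2 / pi \<le> 2"
  proof -
    have "sqrt 2 \<le> 1.5" by (rule real_le_lsqrt) (auto simp: power2_eq_square)
    then show ?thesis using pi_gt3 by (simp add: field_simps)
  qed
  finally show ?thesis by (simp add: \<rho>_def mult_right_mono)
qed

section \<open>Separated points on a circle\<close>

text \<open>This is twice the zeta value at 3/2: one copy for the nonnegative and one for the
  negative integers in \<open>sum_int_weight_le\<close>.\<close>

definition int_weight :: real
  where "int_weight = 2 * (\<Sum>k. real (Suc k) powr (-3/2))"

lemma summable_weight: "summable (\<lambda>k. real (Suc k) powr (-3/2))"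
  by (subst summable_Suc_iff) (simp add: summable_real_powr_iff)

lemma int_weight_nonneg: "int_weight \<ge> 0"
  unfolding int_weight_def by (intro mult_nonneg_nonneg suminf_nonneg summable_weight) auto

lemma sum_int_weight_le:
  fixes A :: "int set"
  assumes "finite A"
  shows "(\<Sum>j\<in>A. (1 + \<bar>real_of_int j\<bar>) powr (-3/2)) \<le> int_weight"
proof -
  let ?w = "\<lambda>j. (1 + \<bar>real_of_int j\<bar>) powr (-3/2)"
  have half: "sum ?w B \<le> (\<Sum>k. real (Suc k) powr (-3/2))"
    if "finite B" "inj_on (\<lambda>j. nat \<bar>j\<bar>) B" for B
  proof -
    have "sum ?w B = (\<Sum>k \<in> (\<lambda>j. nat \<bar>j\<bar>) ` B. real (Suc k) powr (-3/2))"
      unfolding sum.reindex[OF that(2)] by (intro sum.cong) auto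
    also have "\<dots> \<le> (\<Sum>k. real (Suc k) powr (-3/2))"
      using that by (intro sum_le_suminf summable_weight) auto
    finally show ?thesis .
  qed
  have "sum ?w A = sum ?w {j \<in> A. j \<ge> 0} + sum ?w {j \<in> A. \<not> j \<ge> 0}"
    using assms by (subst sum.union_disjoint[symmetric]) (auto intro: sum.cong)
  also have "\<dots> \<le> int_weight"
    unfolding int_weight_def mult_2
    using assms by (intro add_mono half) (auto simp: inj_on_def)
  finally show ?thesis .
qed

text \<open>Here \<open>p\<close> will be a coordinate that controls distances on a quarter arc up
  to a factor 2. The point \<open>u\<close> may lie off the arc, so its distance to \<open>A\<close>
  is bounded below separately by \<open>far\<close>; this handles the points whose coordinate is
  close to that of \<open>u\<close>.\<close>

lemma sum_powr_separated_coordinate: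
  fixes p :: "'a :: real_normed_vector \<Rightarrow> real"
  assumes "finite A" "d > 0"
    and sep: "\<And>v w. v \<in> A \<Longrightarrow> w \<in> A \<Longrightarrow> v \<noteq> w \<Longrightarrow> d \<le> 2 * \<bar>p v - p w\<bar>"
    and far: "\<And>v. v \<in> A \<Longrightarrow> d \<le> norm (u - v)"
    and contr: "\<And>v. v \<in> A \<Longrightarrow> \<bar>p u - p v\<bar> \<le> norm (u - v)"
  shows "(\<Sum>v\<in>A. norm (u - v) powr (-3/2)) \<le> 8 * int_weight * d powr (-3/2)"
proof -
  \<comment> \<open>Distinct points have distinct \<open>J\<close>, and \<open>norm (u - v)\<close> is at least of order \<open>d * (1 + \<bar>J v\<bar>)\<close>.\<close>
  define J where "J v = \<lfloor>2 * (p v - p u) / d\<rfloor>" for v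
  have inj: "inj_on J A"
  proof (rule inj_onI, rule ccontr)
    fix v w assume vw: "v \<in> A" "w \<in> A" "J v = J w" "v \<noteq> w"
    have "\<bar>2 * (p v - p u) / d - 2 * (p w - p u) / d\<bar> < 1"
      using vw(3) unfolding J_def by linarith
    also have "2 * (p v - p u) / d - 2 * (p w - p u) / d = 2 * (p v - p w) / d"
      by (simp add: diff_divide_distrib[symmetric] algebra_simps)
    also have "\<bar>2 * (p v - p w) / d\<bar> = 2 * \<bar>p v - p w\<bar> / d"
      using \<open>d > 0\<close> by (simp only: abs_divide abs_mult abs_of_pos abs_numeral)
    finally have "2 * \<bar>p v - p w\<bar> < d"
      using \<open>d > 0\<close> by simp
    then show False using sep[OF vw(1,2,4)] by simp
  qed
  have term_le: "norm (u - v) powr (-3/2) \<le> (8 * d powr (-3/2)) * (1 + \<bar>real_of_int (J v)\<bar>) powr (-3/2)"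
    if "v \<in> A" for v
  proof -
    have "\<bar>real_of_int (J v)\<bar> - 1 \<le> \<bar>2 * (p v - p u) / d\<bar>"
      unfolding J_def by linarith
    also have "\<dots> = 2 * \<bar>p u - p v\<bar> / d" using \<open>d > 0\<close>
      by (simp only: abs_divide abs_mult abs_of_pos abs_numeral abs_minus_commute)
    also have "\<dots> \<le> 2 * norm (u - v) / d"
      using contr[OF that] \<open>d > 0\<close> by (intro divide_right_mono mult_left_mono) auto
    finally have "1 + \<bar>real_of_int (J v)\<bar> \<le> 2 * norm (u - v) / d + 2" by linarith
    \<comment> \<open>The additive 2, one half of it from rounding, is absorbed because
      \<open>norm (u - v) / d\<close> is at least 1.\<close>
    also have "\<dots> \<le> 4 * norm (u - v) / d" using far[OF that] \<open>d > 0\<close> by (simp add: field_simps)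
    finally have le: "d / 4 * (1 + \<bar>real_of_int (J v)\<bar>) \<le> norm (u - v)"
      using \<open>d > 0\<close> by (simp add: field_simps)
    have "norm (u - v) powr (-3/2) \<le> (d / 4 * (1 + \<bar>real_of_int (J v)\<bar>)) powr (-3/2)"
      using \<open>d > 0\<close> by (intro powr_mono2' le) auto
    also have "\<dots> = (d / 4) powr (-3/2) * (1 + \<bar>real_of_int (J v)\<bar>) powr (-3/2)"
      using \<open>d > 0\<close> by (intro powr_mult)
    also have "(d / 4) powr (-3/2) = 8 * d powr (-3/2)"
    proof -
      have "(4 :: real) powr (-3/2) = (2 powr 2) powr (-3/2)" by simp
      also have "\<dots> = 2 powr (-3)" by (simp only: powr_powr) simp
      also have "\<dots> = 1 / 8" by (simp add: powr_minus_divide)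
      finally have "4 powr (-3/2) = (1 / 8 :: real)" .
      then show ?thesis using \<open>d > 0\<close> by (simp only: powr_divide) simp
    qed
    finally show ?thesis .
  qed
  have "(\<Sum>v\<in>A. norm (u - v) powr (-3/2)) \<le> (\<Sum>v\<in>A. (8 * d powr (-3/2)) * (1 + \<bar>real_of_int (J v)\<bar>) powr (-3/2))"
    by (intro sum_mono term_le)
  also have "\<dots> = (8 * d powr (-3/2)) * (\<Sum>j \<in> J ` A. (1 + \<bar>real_of_int j\<bar>) powr (-3/2))"
    unfolding sum.reindex[OF inj] by (simp add: sum_distrib_left)
  also have "\<dots> \<le> (8 * d powr (-3/2)) * int_weight"
    using assms by (intro mult_left_mono sum_int_weight_le) auto
  finally show ?thesis by (simp add: mult_ac)
qed

section \<open>Decomposition of a circle into quarter arcs\<close>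

text \<open>Equal radii give \<open>(b - d) * (b + d) = (c - a) * (c + a)\<close>, and on this arc
  \<open>\<bar>c + a\<bar> \<le> b + d\<close>. Geometrically, the arc is a graph of slope at most 1
  in absolute value.\<close>

lemma quarter_arc_lipschitz:
  fixes a b c d :: real
  assumes "a\<^sup>2 + b\<^sup>2 = c\<^sup>2 + d\<^sup>2" "\<bar>a\<bar> \<le> b" "\<bar>c\<bar> \<le> d"
  shows "\<bar>b - d\<bar> \<le> \<bar>a - c\<bar>"
proof (cases "b + d = 0")
  case True
  then show ?thesis using assms by simp
next
  case False
  then have pos: "b + d > 0" using assms by linarith
  have "(b - d) * (b + d) = (c - a) * (c + a)"
    using assms(1) by (simp add: algebra_simps power2_eq_square)
  then have "\<bar>b - d\<bar> * (b + d) = \<bar>a - c\<bar> * \<bar>c + a\<bar>"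
    using pos by (metis abs_minus_commute abs_mult abs_of_pos)
  also have "\<dots> \<le> \<bar>a - c\<bar> * (b + d)"
    using assms by (intro mult_left_mono) auto
  finally show ?thesis using pos by simp
qed

text \<open>Neighbouring quarter arcs share their end points; nonnegativity of \<open>f\<close> lets
  the overlaps be counted twice.\<close>

lemma sum_Un4_le:
  fixes f :: "'a \<Rightarrow> real"
  assumes "finite A" "A \<subseteq> A1 \<union> A2 \<union> A3 \<union> A4" "\<And>v. f v \<ge> 0"
    and "sum f (A \<inter> A1) \<le> b" "sum f (A \<inter> A2) \<le> b" "sum f (A \<inter> A3) \<le> b" "sum f (A \<inter> A4) \<le> b"
  shows "sum f A \<le> 4 * b"
proof -
  have Un: "sum f (B \<union> C) \<le> sum f B + sum f C" if "finite B" "finite C" for B C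
    using sum.union_inter[OF that, of f] sum_nonneg[of "B \<inter> C" f, OF assms(3)] by linarith
  have "sum f A = sum f ((A \<inter> A1 \<union> A \<inter> A2) \<union> (A \<inter> A3 \<union> A \<inter> A4))"
    using assms(2) by (intro arg_cong[of _ _ "sum f"]) auto
  also have "\<dots> \<le> (sum f (A \<inter> A1) + sum f (A \<inter> A2)) + (sum f (A \<inter> A3) + sum f (A \<inter> A4))"
    using assms(1) by (intro order_trans[OF Un] add_mono Un) auto
  finally show ?thesis using assms(4-) by linarith
qed

text \<open>On each quarter arc one coordinate dominates the change of the other, so the distance is
  at most twice the change of that coordinate. Four arcs with constant 8 each give 32, whatever the
  number of points.\<close>

lemma sum_powr_separated_on_circle:
  fixes V :: "(real \<times> real) set"
  assumes "finite V" "d > 0" "u \<in> V"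
    and circle: "\<And>v. v \<in> V \<Longrightarrow> norm v = R"
    and sep: "\<And>v w. v \<in> V \<Longrightarrow> w \<in> V \<Longrightarrow> v \<noteq> w \<Longrightarrow> d \<le> norm (v - w)"
  shows "(\<Sum>v\<in>V - {u}. norm (u - v) powr (-3/2)) \<le> 32 * int_weight * d powr (-3/2)"
proof -
  have sq: "(fst v)\<^sup>2 + (snd v)\<^sup>2 = (fst w)\<^sup>2 + (snd w)\<^sup>2" if "v \<in> V" "w \<in> V" for v w
    using circle[OF that(1)] circle[OF that(2)] unfolding norm_prod_def
    by (metis real_norm_def power2_abs real_sqrt_eq_iff)
  have coord: "\<bar>fst v - fst w\<bar> \<le> norm (v - w)" "\<bar>snd v - snd w\<bar> \<le> norm (v - w)" for v w :: "real \<times> real"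
    using norm_fst_le[of "fst v - fst w" "snd v - snd w"] norm_snd_le[of "snd v - snd w" "fst v - fst w"]
    by (simp_all add: minus_prod_def)
  have le: "norm (v - w) \<le> \<bar>fst v - fst w\<bar> + \<bar>snd v - snd w\<bar>" for v w :: "real \<times> real"
    using norm_Pair_le[of "fst v - fst w" "snd v - snd w"] by (simp add: minus_prod_def)
  define A1 A2 A3 A4 :: "(real \<times> real) set" where
    "A1 = {v. \<bar>fst v\<bar> \<le> snd v}" and "A2 = {v. \<bar>fst v\<bar> \<le> - snd v}" and
    "A3 = {v. \<bar>snd v\<bar> \<le> fst v}" and "A4 = {v. \<bar>snd v\<bar> \<le> - fst v}"
  have main: "(\<Sum>v\<in>(V - {u}) \<inter> A. norm (u - v) powr (-3/2)) \<le> 8 * int_weight * d powr (-3/2)"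
    if "\<And>v w. v \<in> V \<Longrightarrow> w \<in> V \<Longrightarrow> v \<in> A \<Longrightarrow> w \<in> A \<Longrightarrow> norm (v - w) \<le> 2 * \<bar>p v - p w\<bar>"
      "\<And>v. \<bar>p u - p v\<bar> \<le> norm (u - v)" for A p
  proof (rule sum_powr_separated_coordinate[where p = p])
    show "d \<le> 2 * \<bar>p v - p w\<bar>"
      if "v \<in> (V - {u}) \<inter> A" "w \<in> (V - {u}) \<inter> A" "v \<noteq> w" for v w
      using that sep[of v w] \<open>\<And>v w. v \<in> V \<Longrightarrow> w \<in> V \<Longrightarrow> v \<in> A \<Longrightarrow> w \<in> A \<Longrightarrow> norm (v - w) \<le> 2 * \<bar>p v - p w\<bar>\<close>[of v w]
      by force
    show "d \<le> norm (u - v)" if "v \<in> (V - {u}) \<inter> A" for v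
      using that assms(3) by (intro sep) auto
  qed (use assms that in auto)
  have "(\<Sum>v\<in>V - {u}. norm (u - v) powr (-3/2)) \<le> 4 * (8 * int_weight * d powr (-3/2))"
  proof (rule sum_Un4_le[where ?A1.0 = A1 and ?A2.0 = A2 and ?A3.0 = A3 and ?A4.0 = A4])
    show "V - {u} \<subseteq> A1 \<union> A2 \<union> A3 \<union> A4"
      by (auto simp: A1_def A2_def A3_def A4_def)
    show "(\<Sum>v\<in>(V - {u}) \<inter> A1. norm (u - v) powr (-3/2)) \<le> 8 * int_weight * d powr (-3/2)"
    proof (rule main[where p = fst, OF _ coord(1)])
      fix v w assume "v \<in> V" "w \<in> V" "v \<in> A1" "w \<in> A1"
      then show "norm (v - w) \<le> 2 * \<bar>fst v - fst w\<bar>"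
        using quarter_arc_lipschitz[of "fst v" "snd v" "fst w" "snd w"] sq[of v w] le[of v w]
        by (simp add: A1_def)
    qed
    show "(\<Sum>v\<in>(V - {u}) \<inter> A2. norm (u - v) powr (-3/2)) \<le> 8 * int_weight * d powr (-3/2)"
    proof (rule main[where p = fst, OF _ coord(1)])
      fix v w assume "v \<in> V" "w \<in> V" "v \<in> A2" "w \<in> A2"
      then show "norm (v - w) \<le> 2 * \<bar>fst v - fst w\<bar>"
        using quarter_arc_lipschitz[of "fst v" "- snd v" "fst w" "- snd w"] sq[of v w] le[of v w]
        by (simp add: A2_def abs_minus_commute)
    qed
    show "(\<Sum>v\<in>(V - {u}) \<inter> A3. norm (u - v) powr (-3/2)) \<le> 8 * int_weight * d powr (-3/2)"
    proof (rule main[where p = snd, OF _ coord(2)])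
      fix v w assume "v \<in> V" "w \<in> V" "v \<in> A3" "w \<in> A3"
      then show "norm (v - w) \<le> 2 * \<bar>snd v - snd w\<bar>"
        using quarter_arc_lipschitz[of "snd v" "fst v" "snd w" "fst w"] sq[of v w] le[of v w]
        by (simp add: A3_def)
    qed
    show "(\<Sum>v\<in>(V - {u}) \<inter> A4. norm (u - v) powr (-3/2)) \<le> 8 * int_weight * d powr (-3/2)"
    proof (rule main[where p = snd, OF _ coord(2)])
      fix v w assume "v \<in> V" "w \<in> V" "v \<in> A4" "w \<in> A4"
      then show "norm (v - w) \<le> 2 * \<bar>snd v - snd w\<bar>"
        using quarter_arc_lipschitz[of "snd v" "- fst v" "snd w" "- fst w"] sq[of v w] le[of v w]
        by (simp add: A4_def abs_minus_commute)
    qed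
  qed (use assms in auto)
  then show ?thesis by simp
qed

section \<open>Lattice points and their separation\<close>

lemma finite_lattice_points: "finite (lattice_points n)"
proof -
  let ?I = "real_of_int ` {- int n..int n}"
  have "\<bar>k\<bar> \<le> int n" if "(real_of_int k)\<^sup>2 \<le> real n" for k
  proof -
    have "k\<^sup>2 \<le> int n" using that by (metis of_int_le_iff of_int_of_nat_eq of_int_power)
    moreover have "\<bar>k\<bar> * 1 \<le> \<bar>k\<bar> * \<bar>k\<bar>"
      by (cases "k = 0") (auto intro!: mult_left_mono simp del: mult_1_right abs_mult_self_eq)
    ultimately show ?thesis by (simp add: power2_eq_square)
  qed
  then have *: "real_of_int k \<in> ?I" if "(real_of_int k)\<^sup>2 \<le> real n" for k
    using that by (intro imageI) (fastforce simp: abs_le_iff)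
  have "lattice_points n \<subseteq> ?I \<times> ?I"
  proof safe
    fix x y assume "(x, y) \<in> lattice_points n"
    then obtain k l where kl: "x = of_int k" "y = of_int l" "x\<^sup>2 + y\<^sup>2 = real n"
      by (auto simp: lattice_points_def norm_Pair Ints_def)
    then have "x\<^sup>2 \<le> real n" "y\<^sup>2 \<le> real n"
      using zero_le_power2[of x] zero_le_power2[of y] by linarith+
    then show "x \<in> ?I" "y \<in> ?I" using * kl by simp_all
  qed
  then show ?thesis by (rule finite_subset) auto
qed

text \<open>The given pair is a member of the finite set of distances, so the unspecified
  \<open>Min\<close> of the empty set does not arise.\<close>

lemma min_separation_le:
  assumes "v \<in> lattice_points n" "w \<in> lattice_points n" "v \<noteq> w"
  shows "min_separation n \<le> norm (v - w)"
  unfolding min_separation_def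
proof (rule Min_le)
  show "finite {norm (v - w) | v w. v \<in> lattice_points n \<and> w \<in> lattice_points n \<and> v \<noteq> w}"
    by (rule finite_subset[of _ "(\<lambda>(v, w). norm (v - w)) ` (lattice_points n \<times> lattice_points n)"])
      (fastforce simp: finite_lattice_points)+
qed (use assms in blast)

text \<open>Replace \<open>a v * a w\<close> by the mean of the two squares. By symmetry of
  \<open>k\<close> both squares contribute the same double sum, in which the row bound
  applies.\<close>

lemma schur_test_symmetric:
  fixes a :: "'a \<Rightarrow> real" and k :: "'a \<Rightarrow> 'a \<Rightarrow> real"
  assumes "finite V" and sym: "\<And>v w. k v w = k w v" and nonneg: "\<And>v w. k v w \<ge> 0"
    and row: "\<And>v. v \<in> V \<Longrightarrow> (\<Sum>w\<in>V - {v}. k v w) \<le> M"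
  shows "(\<Sum>v\<in>V. \<Sum>w\<in>V - {v}. a v * a w * k v w) \<le> M * (\<Sum>v\<in>V. (a v)\<^sup>2)"
proof -
  have flip: "(\<Sum>v\<in>V. \<Sum>w\<in>V - {v}. (a w)\<^sup>2 * k v w) = (\<Sum>v\<in>V. \<Sum>w\<in>V - {v}. (a v)\<^sup>2 * k v w)"
  proof -
    have "(\<Sum>v\<in>V. \<Sum>w\<in>V - {v}. (a w)\<^sup>2 * k v w) = (\<Sum>w\<in>V. \<Sum>v\<in>V - {w}. (a w)\<^sup>2 * k v w)"
      using sum.swap_restrict[OF assms(1) assms(1), of "\<lambda>v w. (a w)\<^sup>2 * k v w" "(\<noteq>)"]
      by (simp add: set_diff_eq eq_commute)
    then show ?thesis by (simp only: sym)
  qed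
  have "(\<Sum>v\<in>V. \<Sum>w\<in>V - {v}. a v * a w * k v w)
      \<le> (\<Sum>v\<in>V. \<Sum>w\<in>V - {v}. ((a v)\<^sup>2 * k v w + (a w)\<^sup>2 * k v w) / 2)"
  proof (intro sum_mono)
    fix v w
    have "a v * a w \<le> ((a v)\<^sup>2 + (a w)\<^sup>2) / 2"
      using zero_le_power2[of "a v - a w"] by (simp add: power2_eq_square algebra_simps)
    then have "a v * a w * k v w \<le> ((a v)\<^sup>2 + (a w)\<^sup>2) / 2 * k v w"
      using nonneg by (rule mult_right_mono)
    then show "a v * a w * k v w \<le> ((a v)\<^sup>2 * k v w + (a w)\<^sup>2 * k v w) / 2"
      by (simp add: algebra_simps)
  qed
  also have "\<dots> = (\<Sum>v\<in>V. \<Sum>w\<in>V - {v}. (a v)\<^sup>2 * k v w)"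
    using flip by (simp add: sum.distrib flip: sum_divide_distrib)
  also have "\<dots> = (\<Sum>v\<in>V. (a v)\<^sup>2 * (\<Sum>w\<in>V - {v}. k v w))"
    by (simp add: sum_distrib_left)
  also have "\<dots> \<le> (\<Sum>v\<in>V. (a v)\<^sup>2 * M)"
    by (intro sum_mono mult_left_mono row) auto
  finally show ?thesis by (simp add: sum_distrib_left mult.commute)
qed

section \<open>Averages over discs\<close>

lemma integrable_unit_exp_ball:
  fixes \<xi> x :: "'a :: euclidean_space"
  shows "integrable lborel (\<lambda>y. indicator (ball x r) y *\<^sub>R unit_exp (y \<bullet> \<xi>))"
  by (rule integrable_indicator_bounded_times[where B = 1])
    (auto intro!: borel_measurable_continuous_onI continuous_intros)

lemma disc_integral_exponential_sum:
  fixes f :: "real \<times> real \<Rightarrow> real" and c :: "real \<times> real \<Rightarrow> complex"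
  assumes "finite V" "r > 0"
    and f: "\<And>x. complex_of_real (f x) = (\<Sum>v\<in>V. c v * unit_exp (x \<bullet> v))"
  shows "complex_of_real (LINT y:ball x r|lborel. (f y)\<^sup>2) =
    of_real (pi * r\<^sup>2 * (\<Sum>v\<in>V. (cmod (c v))\<^sup>2)) +
    (\<Sum>v\<in>V. \<Sum>w\<in>V - {v}. c v * cnj (c w) * (LINT y:ball x r|lborel. unit_exp (y \<bullet> (v - w))))"
proof -
  define I where "I \<xi> = (LINT y:ball x r|lborel. unit_exp (y \<bullet> \<xi>))" for \<xi>
  have I0: "I 0 = of_real (pi * r\<^sup>2)"
  proof -
    have "I 0 = complex_of_real (measure lborel (ball x r))"
      unfolding I_def set_lebesgue_integral_def
      using integrable_unit_exp_ball[of x r 0]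
      by (simp add: scaleR_conv_of_real emeasure_bounded_finite)
    also have "measure lborel (ball x r) = pi * r\<^sup>2"
      using assms content_ball[of r x] by (simp add: unit_ball_vol_2 eval_nat_numeral)
    finally show ?thesis .
  qed
  have sq: "complex_of_real ((f y)\<^sup>2) = (\<Sum>v\<in>V. \<Sum>w\<in>V. c v * cnj (c w) * unit_exp (y \<bullet> (v - w)))" for y
  proof -
    \<comment> \<open>As \<open>f\<close> is real, its square is also the product with the
      conjugate; this produces the frequencies \<open>v - w\<close> and the diagonal coefficients
      \<open>c v * cnj (c v)\<close>.\<close>
    have "complex_of_real ((f y)\<^sup>2) = complex_of_real (f y) * cnj (complex_of_real (f y))"
      by (simp add: power2_eq_square)
    also have "\<dots> = (\<Sum>v\<in>V. \<Sum>w\<in>V. c v * cnj (c w) * unit_exp (y \<bullet> (v - w)))"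
      unfolding f sum_product cnj_sum complex_cnj_mult cnj_unit_exp
      by (simp add: inner_diff_right mult_ac flip: unit_exp_add)
    finally show ?thesis .
  qed
  have "complex_of_real (LINT y:ball x r|lborel. (f y)\<^sup>2)
      = (LINT y|lborel. of_real (indicator (ball x r) y *\<^sub>R (f y)\<^sup>2))"
    unfolding set_lebesgue_integral_def by (rule integral_complex_of_real[symmetric])
  also have "\<dots> = (LINT y|lborel. (\<Sum>v\<in>V. \<Sum>w\<in>V. c v * cnj (c w) *
      (indicator (ball x r) y *\<^sub>R unit_exp (y \<bullet> (v - w)))))"
    unfolding real_scaleR_def of_real_mult sq
    by (simp add: sum_distrib_left scaleR_conv_of_real mult_ac)
  also have "\<dots> = (\<Sum>v\<in>V. \<Sum>w\<in>V. c v * cnj (c w) * I (v - w))"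
    unfolding I_def set_lebesgue_integral_def
    by (simp only: Bochner_Integration.integral_sum Bochner_Integration.integrable_sum
        integrable_mult_right integral_mult_right_zero integrable_unit_exp_ball)
  also have "\<dots> = (\<Sum>v\<in>V. c v * cnj (c v) * I 0 + (\<Sum>w\<in>V - {v}. c v * cnj (c w) * I (v - w)))"
    using assms(1) by (intro sum.cong refl) (simp add: sum.remove)
  also have "\<dots> = of_real (pi * r\<^sup>2 * (\<Sum>v\<in>V. (cmod (c v))\<^sup>2)) +
      (\<Sum>v\<in>V. \<Sum>w\<in>V - {v}. c v * cnj (c w) * I (v - w))"
    unfolding I0 sum.distrib complex_norm_square
    by (simp add: sum_distrib_left mult_ac flip: complex_norm_square)
  finally show ?thesis by (simp only: I_def)
qed

text \<open>The normalisation makes the diagonal equal to the area of the disc. The rest is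
  dominated by a quadratic form in the numbers \<open>cmod (c v)\<close> with kernel
  \<open>k\<close>, whose row sums the circle estimate bounds; 64 is 2 from the disc transform times
  32.\<close>

lemma eigenfunction_disc_average:
  assumes "normalized_eigenfunction n f" "r > 0" "d > 0"
    and sep: "\<And>v w. v \<in> lattice_points n \<Longrightarrow> w \<in> lattice_points n \<Longrightarrow> v \<noteq> w \<Longrightarrow> d \<le> norm (v - w)"
  shows "\<bar>(LINT y:ball x r|lborel. (f y)\<^sup>2) / (pi * r\<^sup>2) - 1\<bar> \<le> 64 * int_weight * (r * d) powr (-3/2)"
proof -
  define V where "V = lattice_points n"
  have V: "finite V" by (simp add: V_def finite_lattice_points)
  obtain c where c1: "(\<Sum>v\<in>V. (cmod (c v))\<^sup>2) = 1"
    and cf: "\<And>x. complex_of_real (f x) = (\<Sum>v\<in>V. c v * unit_exp (x \<bullet> v))"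
    using assms(1) unfolding normalized_eigenfunction_def V_def by blast
  define I where "I \<xi> = (LINT y:ball x r|lborel. unit_exp (y \<bullet> \<xi>))" for \<xi>
  define S where "S = (\<Sum>v\<in>V. \<Sum>w\<in>V - {v}. c v * cnj (c w) * I (v - w))"
  define Q where "Q = (LINT y:ball x r|lborel. (f y)\<^sup>2)"
  define k where "k v w = norm (v - w) powr (-3/2)" for v w :: "real \<times> real"
  have pos: "pi * r\<^sup>2 > 0" using assms by simp
  have "complex_of_real Q = of_real (pi * r\<^sup>2) + S"
    using disc_integral_exponential_sum[OF V \<open>r > 0\<close> cf, of x] by (simp add: Q_def S_def I_def c1)
  then have "complex_of_real (Q - pi * r\<^sup>2) = S" by (simp add: algebra_simps)
  then have "\<bar>Q - pi * r\<^sup>2\<bar> = norm S" by (metis norm_of_real)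
  moreover have "Q / (pi * r\<^sup>2) - 1 = (Q - pi * r\<^sup>2) / (pi * r\<^sup>2)"
    using assms(2) by (simp add: diff_divide_distrib)
  ultimately have "\<bar>Q / (pi * r\<^sup>2) - 1\<bar> = norm S / (pi * r\<^sup>2)"
    using pos by (simp only: abs_divide abs_of_pos)
  also have "\<dots> \<le> (\<Sum>v\<in>V. \<Sum>w\<in>V - {v}. cmod (c v) * cmod (c w) * norm (I (v - w))) / (pi * r\<^sup>2)"
    unfolding S_def using pos
    by (intro divide_right_mono sum_norm_le) (auto simp: norm_mult intro!: sum_norm_le)
  also have "\<dots> = (\<Sum>v\<in>V. \<Sum>w\<in>V - {v}. cmod (c v) * cmod (c w) * (norm (I (v - w)) / (pi * r\<^sup>2)))"
    by (simp add: sum_divide_distrib)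
  also have "\<dots> \<le> (\<Sum>v\<in>V. \<Sum>w\<in>V - {v}. cmod (c v) * cmod (c w) * (2 * (norm (v - w) * r) powr (-3/2)))"
    unfolding I_def using assms(2) by (intro sum_mono mult_left_mono disc_fourier_bound) auto
  also have "\<dots> = 2 * r powr (-3/2) * (\<Sum>v\<in>V. \<Sum>w\<in>V - {v}. cmod (c v) * cmod (c w) * k v w)"
    using assms(2) by (simp add: k_def powr_mult sum_distrib_left mult_ac)
  also have "\<dots> \<le> 2 * r powr (-3/2) * (32 * int_weight * d powr (-3/2) * (\<Sum>v\<in>V. (cmod (c v))\<^sup>2))"
  proof (intro mult_left_mono schur_test_symmetric V)
    show "(\<Sum>w\<in>V - {v}. k v w) \<le> 32 * int_weight * d powr (-3/2)" if "v \<in> V" for v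
      unfolding k_def
    proof (rule sum_powr_separated_on_circle[OF V \<open>d > 0\<close> that])
      show "norm w = sqrt n" if "w \<in> V" for w
        using that real_sqrt_unique[of "norm w" n] by (simp add: V_def lattice_points_def)
    qed (use sep in \<open>auto simp: V_def\<close>)
  qed (auto simp: k_def norm_minus_commute)
  also have "\<dots> = 64 * int_weight * (r * d) powr (-3/2)"
    using assms by (simp add: c1 powr_mult)
  finally show ?thesis by (simp only: Q_def)
qed

section \<open>Uniformity over centres and radii\<close>

theorem theorem1p2:
  fixes \<epsilon> \<delta> \<eta> C :: real
  assumes "\<delta> > 0" and "\<epsilon> > \<delta>" and "0 < \<eta>" and "\<eta> < \<epsilon> - \<delta>" and "C > 0"
  shows "\<exists>(n\<^sub>0 :: nat) (K :: real). K > 0 \<and>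
    (\<forall>n \<in> sums_of_two_squares. n \<ge> n\<^sub>0 \<longrightarrow>
       min_separation n > C * real n powr (1/2 - \<delta>) \<longrightarrow>
       (\<forall>f. normalized_eigenfunction n f \<longrightarrow>
          (SUP (x, r) \<in> (UNIV :: (real \<times> real) set) \<times> {r. r > real n powr (-1/2 + \<epsilon>)}.
             ereal \<bar>(LINT y:ball x r|lborel. (f y)\<^sup>2) / (pi * r\<^sup>2) - 1\<bar>)
          \<le> ereal (K * real n powr (- 3 * \<eta> / 2))))"
proof (intro exI conjI ballI impI allI)
  \<comment> \<open>The summand 1 ensures \<open>K > 0\<close> when only
    \<open>int_weight \<ge> 0\<close> is known.\<close>
  define K where "K = 64 * int_weight * C powr (-3/2) + 1"
  show "K > 0" using int_weight_nonneg by (simp add: K_def add_nonneg_pos)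
  fix n :: nat and f
  \<comment> \<open>The threshold is 1: from there on powers of \<open>n\<close> are positive and
    monotone in the exponent.\<close>
  assume n: "n \<ge> 1" and sep: "min_separation n > C * real n powr (1/2 - \<delta>)"
    and f: "normalized_eigenfunction n f"
  define d where "d = C * real n powr (1/2 - \<delta>)"
  have d: "d > 0" using n assms by (simp add: d_def)
  show "(SUP (x, r) \<in> (UNIV :: (real \<times> real) set) \<times> {r. r > real n powr (-1/2 + \<epsilon>)}.
             ereal \<bar>(LINT y:ball x r|lborel. (f y)\<^sup>2) / (pi * r\<^sup>2) - 1\<bar>)
          \<le> ereal (K * real n powr (- 3 * \<eta> / 2))"
  \<comment> \<open>In the extended reals a bound for each centre and radius suffices, with no
    boundedness to check first.\<close>
  proof (rule SUP_least, clarify, unfold ereal_less_eq)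
    fix x :: "real \<times> real" and r
    assume r: "real n powr (-1/2 + \<epsilon>) < r"
    then have r0: "r > 0" by (rule le_less_trans[OF powr_ge_zero])
    have "\<bar>(LINT y:ball x r|lborel. (f y)\<^sup>2) / (pi * r\<^sup>2) - 1\<bar> \<le> 64 * int_weight * (r * d) powr (-3/2)"
      using sep min_separation_le
      by (intro eigenfunction_disc_average[OF f r0 d]) (fastforce simp: d_def)
    also have "\<dots> \<le> 64 * int_weight * (C powr (-3/2) * real n powr (- 3 * \<eta> / 2))"
    proof (intro mult_left_mono)
      \<comment> \<open>The exponents \<open>-1/2 + \<epsilon>\<close> of the radius and
        \<open>1/2 - \<delta>\<close> of the separation add up to
        \<open>\<epsilon> - \<delta>\<close>, which is then weakened to
        \<open>\<eta>\<close>.\<close>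
      have "C * real n powr (\<epsilon> - \<delta>) = real n powr (-1/2 + \<epsilon>) * d"
        by (simp add: d_def flip: powr_add)
      also have "\<dots> \<le> r * d" using r d by simp
      finally have "(r * d) powr (-3/2) \<le> (C * real n powr (\<epsilon> - \<delta>)) powr (-3/2)"
        using n assms by (intro powr_mono2') auto
      also have "\<dots> = C powr (-3/2) * real n powr ((\<epsilon> - \<delta>) * (-3/2))"
        using assms by (simp add: powr_mult powr_powr)
      also have "\<dots> \<le> C powr (-3/2) * real n powr (- 3 * \<eta> / 2)"
        using n assms by (intro mult_left_mono powr_mono) auto
      finally show "(r * d) powr (-3/2) \<le> C powr (-3/2) * real n powr (- 3 * \<eta> / 2)" .
    qed (use int_weight_nonneg in auto)
    also have "\<dots> \<le> K * real n powr (- 3 * \<eta> / 2)"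
      by (simp add: K_def algebra_simps)
    finally show "\<bar>(LINT y:ball x r|lborel. (f y)\<^sup>2) / (pi * r\<^sup>2) - 1\<bar> \<le> K * real n powr (- 3 * \<eta> / 2)" .
  qed
qed

end
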